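(* Assume $u_{sc}(\cdot,l)\in L^2(\Gamma_r\cup\Gamma_{-r})$ for all $l=1,\dots,N$. For $\delta>0$ let $u_{sc,\delta}(\cdot,l)$, $l=1,\dots,N$, be noisy scattered fields with Rayleigh coefficients $(u^\pm_{\delta,j}(l))_{j\in\mathbb{Z}}$, for which $$\sum_{l=1}^N\|u_{sc,\delta}(\cdot,l)-u_{sc}(\cdot,l)\|_{L^2(\Gamma_r\cup\Gamma_{-r})}\le\delta .$$ Define, for $z\in\Omega=(-\pi,\pi)\times\mathbb{R}$, $$I(z)=\sum_{l=1}^N\Big|\sum_{j:\beta_j>0}\beta_j\Big(u_j^+(l)\,\overline{g_j^+(z)}+u_j^-(l)\,\overline{g_j^-(z)}\Big)\Big|^p,$$ $$I_\delta(z)=\sum_{l=1}^N\Big|\sum_{j:\beta_j>0}\beta_j\Big(u_{\delta,j}^+(l)\,\overline{g_j^+(z)}+u_{\delta,j}^-(l)\,\overline{g_j^-(z)}\Big)\Big|^p.$$ Then for every $z\in\Omega$, $$|I_\delta(z)-I(z)|=O(\delta)\quad\text{as }\delta\to0.$$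
   Context: Let $k>0$, $\alpha\in\mathbb{R}$, $p\in\mathbb{N}=\{1,2,\dots\}$ and let $N\ge 1$ be an integer (the number of incident fields). A function $f$ on $\mathbb{R}^2$ is $\alpha$-quasiperiodic (in $x_1$) if $f(x_1+2\pi j,x_2)=e^{i2\pi j\alpha}f(x_1,x_2)$ for all $j\in\mathbb{Z}$ and $(x_1,x_2)\in\mathbb{R}^2$. Medium: $n$ is a bounded function on $\mathbb{R}^2$, $2\pi$-periodic in $x_1$, equal to $1$ outside the periodic medium, which is bounded in the $x_2$-direction. The contrast is $q=n-1$. Put $\Omega=(-\pi,\pi)\times\mathbb{R}$, $D=\operatorname{supp}(q)\cap\Omega$, fix $h>0$ with $h>\sup\{|x_2|:(x_1,x_2)\in D\}$, fix $r\ge h$, and set $\Gamma_{\pm r}=(-\pi,\pi)\times\{\pm r\}$ (the measurement lines). For $j\in\mathbb{Z}$ set $\alpha_j=\alpha+j$, and $\beta_j=\sqrt{k^2-\alpha_j^2}$ if $k^2\ge\alpha_j^2$, $\beta_j=i\sqrt{\alpha_j^2-k^2}$ if $k^2<\alpha_j^2$. It is assumed that $\beta_j\ne0$ for all $j\in\mathbb{Z}$. The condition "$\beta_j>0$" means $\beta_j$ is real and positive, i.e. $k^2>\alpha_j^2$; this holds for only finitely many $j$. Scattering problem: for $l=1,\dots,N$, $u_{in}(\cdot,l)$ is an $\alpha$-quasiperiodic incident field, $u_{sc}(\cdot,l)$ is the corresponding scattered field, and $u(\cdot,l)=u_{in}(\cdot,l)+u_{sc}(\cdot,l)$ is the total field.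 The scattered field $u_{sc}(\cdot,l)$ is $\alpha$-quasiperiodic and solves $\Delta u_{sc}(\cdot,l)+k^2u_{sc}(\cdot,l)=-k^2q\,u(\cdot,l)$ in $\mathbb{R}^2$ (in the usual weak sense, $u_{sc}(\cdot,l)\in H^1_{loc}(\mathbb{R}^2)$), together with the Rayleigh expansion (radiation) condition $$u_{sc}(x,l)=\sum_{j\in\mathbb{Z}}u_j^+(l)\,e^{i\alpha_jx_1+i\beta_j(x_2-h)}\ \ (x_2\ge h),\qquad u_{sc}(x,l)=\sum_{j\in\mathbb{Z}}u_j^-(l)\,e^{i\alpha_jx_1-i\beta_j(x_2+h)}\ \ (x_2\le -h).$$ The complex numbers $u_j^\pm(l)$ are the Rayleigh coefficients of $u_{sc}(\cdot,l)$; equivalently, for $j$ with $\beta_j>0$, $$u_j^\pm(l)=\frac{e^{-i\beta_j(r-h)}}{2\pi}\int_{\Gamma_{\pm r}}u_{sc}(x,l)\,e^{-i\alpha_jx_1}\,ds(x).$$ The noisy fields $u_{sc,\delta}(\cdot,l)$ are functions in $L^2(\Gamma_r\cup\Gamma_{-r})$, and their Rayleigh coefficients $u_{\delta,j}^\pm(l)$ (for $\beta_j>0$, the only ones used) are given by the same formula with $u_{sc}(\cdot,l)$ replaced by $u_{sc,\delta}(\cdot,l)$. For $j\in\mathbb{Z}$ and $z=(z_1,z_2)\in\Omega$, $$g_j^\pm(z)=\frac{i}{4\pi\beta_j}e^{-i\alpha_jz_1\mp i\beta_j(z_2\mp h)},$$ with upper signs for $g_j^+$ and lower signs for $g_j^-$.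 The quantities $k,\alpha,p,N,h,r$, the medium and the incident fields are fixed as $\delta\to0$. *)

theory Defs
  imports "HOL-Analysis.Analysis" "HOL-Library.Landau_Symbols"
begin

type_synonym field = "real \<times> real \<Rightarrow> complex"

definition quasiperiodic :: "real \<Rightarrow> field \<Rightarrow> bool" where
  "quasiperiodic \<alpha> f \<longleftrightarrow>
     (\<forall>(j::int) x1 x2. f (x1 + 2 * pi * of_int j, x2) =
        exp (\<i> * of_real (2 * pi * of_int j * \<alpha>)) * f (x1, x2))"

definition \<Omega> :: "(real \<times> real) set" where
  "\<Omega> = {-pi<..<pi} \<times> UNIV"


text \<open>Smooth functions form the largest class of Frechet differentiable functions that is closed
  under taking directional derivatives.\<close>

coinductive smooth :: "(real \<times> real \<Rightarrow> real) \<Rightarrow> bool" where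
  "(\<And>x. (f has_derivative f' x) (at x)) \<Longrightarrow> (\<And>v. smooth (\<lambda>x. f' x v)) \<Longrightarrow> smooth f"

definition test_function :: "(real \<times> real \<Rightarrow> real) \<Rightarrow> bool" where
  "test_function \<phi> \<longleftrightarrow> smooth \<phi> \<and> compact (closure {x. \<phi> x \<noteq> 0})"

definition partial1 :: "(real \<times> real \<Rightarrow> real) \<Rightarrow> real \<times> real \<Rightarrow> real" where
  "partial1 \<phi> x = frechet_derivative \<phi> (at x) (1, 0)"

definition partial2 :: "(real \<times> real \<Rightarrow> real) \<Rightarrow> real \<times> real \<Rightarrow> real" where
  "partial2 \<phi> x = frechet_derivative \<phi> (at x) (0, 1)"

definition L2_loc :: "field \<Rightarrow> bool" where
  "L2_loc f \<longleftrightarrow> f \<in> borel_measurable lebesgue \<and>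
     (\<forall>K. compact K \<longrightarrow> set_integrable lebesgue K (\<lambda>x. (cmod (f x))\<^sup>2))"

definition weak_gradient :: "field \<Rightarrow> field \<Rightarrow> field \<Rightarrow> bool" where
  "weak_gradient u g1 g2 \<longleftrightarrow> L2_loc g1 \<and> L2_loc g2 \<and>
     (\<forall>\<phi>. test_function \<phi> \<longrightarrow>
        (LINT x|lebesgue. partial1 \<phi> x *\<^sub>R u x) = - (LINT x|lebesgue. \<phi> x *\<^sub>R g1 x) \<and>
        (LINT x|lebesgue. partial2 \<phi> x *\<^sub>R u x) = - (LINT x|lebesgue. \<phi> x *\<^sub>R g2 x))"

definition H1_loc :: "field \<Rightarrow> bool" where
  "H1_loc u \<longleftrightarrow> L2_loc u \<and> (\<exists>g1 g2. weak_gradient u g1 g2)"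

text \<open>Weak form of \<open>\<Delta> v + k\<^sup>2 v = - k\<^sup>2 q u\<close> in the plane. Real test functions
  suffice by linearity; the weak gradient is unique up to null sets.\<close>

definition weak_helmholtz_solution :: "real \<Rightarrow> field \<Rightarrow> field \<Rightarrow> field \<Rightarrow> bool" where
  "weak_helmholtz_solution k q u v \<longleftrightarrow> H1_loc v \<and>
     (\<exists>g1 g2. weak_gradient v g1 g2 \<and>
        (\<forall>\<phi>. test_function \<phi> \<longrightarrow>
           (LINT x|lebesgue. partial1 \<phi> x *\<^sub>R g1 x + partial2 \<phi> x *\<^sub>R g2 x
               - (k\<^sup>2 * \<phi> x) *\<^sub>R v x)
           = (LINT x|lebesgue. (k\<^sup>2 * \<phi> x) *\<^sub>R (q x * u x))))"


definition periodic_medium :: "field \<Rightarrow> bool" where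
  "periodic_medium n \<longleftrightarrow> n \<in> borel_measurable lebesgue \<and> bounded (range n) \<and>
     (\<forall>x1 x2. n (x1 + 2 * pi, x2) = n (x1, x2)) \<and>
     (\<exists>b. \<forall>x1 x2. \<bar>x2\<bar> > b \<longrightarrow> n (x1, x2) = 1)"

definition contrast :: "field \<Rightarrow> field" where
  "contrast n x = n x - 1"

definition scatterer :: "field \<Rightarrow> (real \<times> real) set" where
  "scatterer q = closure {x. q x \<noteq> 0} \<inter> \<Omega>"


definition alpha :: "real \<Rightarrow> int \<Rightarrow> real" where
  "alpha \<alpha> j = \<alpha> + of_int j"

definition beta :: "real \<Rightarrow> real \<Rightarrow> int \<Rightarrow> complex" where
  "beta k \<alpha> j =
     (if k\<^sup>2 \<ge> (alpha \<alpha> j)\<^sup>2 then of_real (sqrt (k\<^sup>2 - (alpha \<alpha> j)\<^sup>2))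
      else \<i> * of_real (sqrt ((alpha \<alpha> j)\<^sup>2 - k\<^sup>2)))"

definition propagating :: "real \<Rightarrow> real \<Rightarrow> int set" where
  "propagating k \<alpha> = {j. beta k \<alpha> j \<in> \<real> \<and> Re (beta k \<alpha> j) > 0}"

definition rayleigh_expansion ::
    "real \<Rightarrow> real \<Rightarrow> real \<Rightarrow> field \<Rightarrow> (int \<Rightarrow> complex) \<Rightarrow> (int \<Rightarrow> complex) \<Rightarrow> bool" where
  "rayleigh_expansion k \<alpha> h v up um \<longleftrightarrow>
     (\<forall>x1 x2. x2 \<ge> h \<longrightarrow>
        ((\<lambda>j. up j * exp (\<i> * of_real (alpha \<alpha> j * x1) + \<i> * beta k \<alpha> j * of_real (x2 - h)))
           has_sum v (x1, x2)) UNIV) \<and>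
     (\<forall>x1 x2. x2 \<le> - h \<longrightarrow>
        ((\<lambda>j. um j * exp (\<i> * of_real (alpha \<alpha> j * x1) - \<i> * beta k \<alpha> j * of_real (x2 + h)))
           has_sum v (x1, x2)) UNIV)"

text \<open>\<open>up\<close> and \<open>um\<close> are the Rayleigh coefficients of the scattered field \<open>usc\<close> above and below
  the medium.\<close>

definition scattered_field ::
    "real \<Rightarrow> real \<Rightarrow> real \<Rightarrow> field \<Rightarrow> field \<Rightarrow> field \<Rightarrow>
     (int \<Rightarrow> complex) \<Rightarrow> (int \<Rightarrow> complex) \<Rightarrow> bool" where
  "scattered_field k \<alpha> h n uin usc up um \<longleftrightarrow>
     quasiperiodic \<alpha> usc \<and>
     weak_helmholtz_solution k (contrast n) (\<lambda>x. uin x + usc x) usc \<and>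
     rayleigh_expansion k \<alpha> h usc up um"


text \<open>Arc length on the horizontal segments \<open>(-\<pi>,\<pi>) \<times> {\<plusminus>r}\<close> is Lebesgue measure in the
  first coordinate; the two segments are disjoint for \<open>r > 0\<close>.\<close>

definition L2_lines :: "real \<Rightarrow> field \<Rightarrow> bool" where
  "L2_lines r f \<longleftrightarrow>
     (\<forall>s\<in>{r, -r}.
        (\<lambda>t. f (t, s)) \<in> borel_measurable (lebesgue_on {-pi<..<pi}) \<and>
        integrable (lebesgue_on {-pi<..<pi}) (\<lambda>t. (cmod (f (t, s)))\<^sup>2))"

definition L2_lines_norm :: "real \<Rightarrow> field \<Rightarrow> real" where
  "L2_lines_norm r f =
     sqrt ((LINT t|lebesgue_on {-pi<..<pi}. (cmod (f (t, r)))\<^sup>2) +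
           (LINT t|lebesgue_on {-pi<..<pi}. (cmod (f (t, -r)))\<^sup>2))"

definition coeff_plus :: "real \<Rightarrow> real \<Rightarrow> real \<Rightarrow> real \<Rightarrow> field \<Rightarrow> int \<Rightarrow> complex" where
  "coeff_plus k \<alpha> h r f j =
     exp (- \<i> * beta k \<alpha> j * of_real (r - h)) / of_real (2 * pi) *
     (LINT t|lebesgue_on {-pi<..<pi}. f (t, r) * exp (- \<i> * of_real (alpha \<alpha> j * t)))"

definition coeff_minus :: "real \<Rightarrow> real \<Rightarrow> real \<Rightarrow> real \<Rightarrow> field \<Rightarrow> int \<Rightarrow> complex" where
  "coeff_minus k \<alpha> h r f j =
     exp (- \<i> * beta k \<alpha> j * of_real (r - h)) / of_real (2 * pi) *
     (LINT t|lebesgue_on {-pi<..<pi}. f (t, -r) * exp (- \<i> * of_real (alpha \<alpha> j * t)))"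


definition g_plus :: "real \<Rightarrow> real \<Rightarrow> real \<Rightarrow> int \<Rightarrow> real \<times> real \<Rightarrow> complex" where
  "g_plus k \<alpha> h j z = \<i> / (of_real (4 * pi) * beta k \<alpha> j) *
     exp (- \<i> * of_real (alpha \<alpha> j * fst z) - \<i> * beta k \<alpha> j * of_real (snd z - h))"

definition g_minus :: "real \<Rightarrow> real \<Rightarrow> real \<Rightarrow> int \<Rightarrow> real \<times> real \<Rightarrow> complex" where
  "g_minus k \<alpha> h j z = \<i> / (of_real (4 * pi) * beta k \<alpha> j) *
     exp (- \<i> * of_real (alpha \<alpha> j * fst z) + \<i> * beta k \<alpha> j * of_real (snd z + h))"

definition imaging_functional ::
    "real \<Rightarrow> real \<Rightarrow> real \<Rightarrow> nat \<Rightarrow> nat \<Rightarrow>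
     (nat \<Rightarrow> int \<Rightarrow> complex) \<Rightarrow> (nat \<Rightarrow> int \<Rightarrow> complex) \<Rightarrow> real \<times> real \<Rightarrow> real" where
  "imaging_functional k \<alpha> h p N up um z =
     (\<Sum>l=1..N. (cmod (\<Sum>j\<in>propagating k \<alpha>. beta k \<alpha> j *
        (up l j * cnj (g_plus k \<alpha> h j z) + um l j * cnj (g_minus k \<alpha> h j z)))) ^ p)"

end

theory Submission
  imports Defs
begin

text \<open>On the measurement lines the Rayleigh series converges absolutely and uniformly, so termwise
  integration identifies the Rayleigh coefficients of the exact field with its Fourier coefficients.
  For propagating modes the phase factor has modulus one, so by Cauchy-Schwarz each coefficient
  is perturbed by at most \<open>\<delta>\<close>. The inner sums depend linearly on the coefficients, and the
  \<open>p\<close>-th power is Lipschitz on bounded sets.\<close>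

section \<open>Cauchy-Schwarz on a finite measure space\<close>

text \<open>This is Cauchy-Schwarz against the constant 1. The second bound comes from expanding a
  nonnegative variance, so that only integrals of \<open>norm (f x)\<close> and of its square
  occur.\<close>

lemma (in finite_measure) norm_integral_le_sqrt:
  fixes f :: "'a \<Rightarrow> 'b::{banach,second_countable_topology}"
  assumes f: "f \<in> borel_measurable M" and f2: "integrable M (\<lambda>x. (norm (f x))\<^sup>2)"
  shows "integrable M f"
    and "norm (integral\<^sup>L M f) \<le> sqrt (measure M (space M) * (\<integral>x. (norm (f x))\<^sup>2 \<partial>M))"
proof -
  \<comment> \<open>Constants are integrable on a finite measure space, so this pointwise bound
    reduces integrability of \<open>f\<close> to that of its square.\<close>
  have bound: "norm (f x) \<le> norm (1 + (norm (f x))\<^sup>2)" for x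
  proof -
    have "0 \<le> (norm (f x) - 1 / 2)\<^sup>2"
      by simp
    then show ?thesis
      by (simp add: power2_eq_square algebra_simps)
  qed
  show int: "integrable M f"
    by (rule Bochner_Integration.integrable_bound[OF _ f AE_I2[OF bound]]) (simp add: f2)
  define m where "m = measure M (space M)"
  define A where "A = (\<integral>x. norm (f x) \<partial>M)"
  define S where "S = (\<integral>x. (norm (f x))\<^sup>2 \<partial>M)"
  have "A\<^sup>2 \<le> m * S"
  \<comment> \<open>The variance inequality carries a factor \<open>m\<close> that has to be
    cancelled. If \<open>m = 0\<close>, the whole space is null and \<open>A\<close>
    vanishes.\<close>
  proof (cases "m = 0")
    case True
    then have "space M \<in> null_sets M"
      by (simp add: m_def emeasure_eq_measure null_sets_def)
    then have "AE x in M. norm (f x) = 0"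
      by (rule AE_I') auto
    then have "A = 0"
      unfolding A_def by (rule integral_eq_zero_AE)
    then show ?thesis
      by (simp add: True)
  next
    case False
    then have m: "m > 0"
      by (simp add: m_def zero_less_measure_iff)
    \<comment> \<open>The deviation of \<open>norm (f x)\<close> from its mean \<open>A / m\<close>,
      scaled by \<open>m\<close> to avoid fractions.\<close>
    have "0 \<le> (\<integral>x. (m * norm (f x) - A)\<^sup>2 \<partial>M)"
      by simp
    also have "\<dots> = (\<integral>x. m\<^sup>2 * (norm (f x))\<^sup>2 - 2 * m * A * norm (f x) + A\<^sup>2 \<partial>M)"
      by (simp add: power2_diff algebra_simps)
    also have "\<dots> = m\<^sup>2 * S - 2 * m * A * A + A\<^sup>2 * m"
      using int f2 by (simp add: S_def A_def m_def)
    also have "\<dots> = m * (m * S - A\<^sup>2)"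
      by (simp add: power2_eq_square algebra_simps)
    finally show ?thesis
      using m by (simp add: zero_le_mult_iff)
  qed
  then have "A \<le> sqrt (m * S)"
    by (rule real_le_rsqrt)
  then show "norm (integral\<^sup>L M f) \<le> sqrt (m * S)"
    unfolding A_def by (rule order_trans[OF integral_norm_bound])
qed

section \<open>Fourier modes on the interval and the Rayleigh coefficients of the exact
  field\<close>

lemma finite_measure_interval: "finite_measure (lebesgue_on {-pi<..<pi})"
  by (rule finite_measure_lebesgue_on) simp

lemma integrable_interval_exp:
  "integrable (lebesgue_on {-pi<..<pi}) (\<lambda>t. exp (\<i> * of_real (c * t)))"
proof (rule finite_measure.integrable_const_bound[OF finite_measure_interval])
  have "continuous_on {-pi<..<pi} (\<lambda>t. exp (\<i> * of_real (c * t)))"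
    by (intro continuous_intros)
  then show "(\<lambda>t. exp (\<i> * of_real (c * t))) \<in> borel_measurable (lebesgue_on {-pi<..<pi})"
    by (rule continuous_imp_measurable_on_sets_lebesgue) simp
  show "AE t in lebesgue_on {-pi<..<pi}. cmod (exp (\<i> * of_real (c * t))) \<le> 1"
    by (simp only: norm_exp_i_times) simp
qed

text \<open>For nonzero \<open>m\<close> the exponential has a primitive of period
  \<open>2 * pi\<close>, whose values at the two endpoints cancel.\<close>

lemma integral_interval_exp:
  fixes m :: int
  shows "(LINT t|lebesgue_on {-pi<..<pi}. exp (\<i> * of_real (of_int m * t))) =
    (if m = 0 then of_real (2 * pi) else 0)"
proof (cases "m = 0")
  case True
  then show ?thesis
    by (simp add: measure_restrict_space scaleR_conv_of_real)
next
  case False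
  let ?F = "\<lambda>t. exp (\<i> * of_real (of_int m * t)) / (\<i> * of_int m)"
  have "((\<lambda>t. exp (\<i> * of_real (of_int m * t))) has_integral ?F pi - ?F (-pi)) {-pi..pi}"
  proof (rule fundamental_theorem_of_calculus)
    fix t :: real
    show "(?F has_vector_derivative exp (\<i> * of_real (of_int m * t))) (at t within {-pi..pi})"
    proof -
      have "((\<lambda>w. exp (\<i> * (of_int m * w)) / (\<i> * of_int m)) has_field_derivative
          exp (\<i> * (of_int m * of_real t))) (at (of_real t))"
        using False by (auto intro!: derivative_eq_intros simp: mult_ac)
      from has_vector_derivative_real_field[OF this] show ?thesis
        by simp
    qed
  qed simp
  moreover have "?F pi - ?F (-pi) = 0"
  proof -
    have "exp (\<i> * of_real (of_int m * pi)) = exp (\<i> * of_real (of_int m * (-pi)))"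
      \<comment> \<open>The two exponents differ by \<open>m\<close> periods of the
        exponential.\<close>
      unfolding exp_eq by (intro exI[of _ m]) (simp add: algebra_simps)
    then show ?thesis
      by simp
  qed
  ultimately have "((\<lambda>t. exp (\<i> * of_real (of_int m * t))) has_integral 0) {-pi<..<pi}"
    by (simp only: has_integral_Icc_iff_Ioo)
  then have "integral {-pi<..<pi} (\<lambda>t. exp (\<i> * of_real (of_int m * t))) = 0"
    by (rule integral_unique)
  then show ?thesis
    using False lebesgue_integral_eq_integral[OF integrable_interval_exp[of "of_int m"]] by simp
qed

text \<open>Convergence at \<open>t = 0\<close> already makes the coefficients absolutely summable, because
  unconditional and absolute convergence coincide in the plane; this dominates the series
  uniformly in \<open>t\<close> and permits termwise integration.\<close>

lemma quasiperiodic_fourier_coefficient: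
  assumes sum: "\<And>t. ((\<lambda>j. a j * exp (\<i> * of_real (alpha \<alpha> j * t))) has_sum f t) UNIV"
  shows "(LINT t|lebesgue_on {-pi<..<pi}. f t * exp (- \<i> * of_real (alpha \<alpha> m * t))) =
    of_real (2 * pi) * a m"
proof -
  let ?M = "lebesgue_on {-pi<..<pi}"
  \<comment> \<open>Multiplication by the conjugate of mode \<open>m\<close> cancels \<alpha> and
    leaves the integer frequency \<open>j - m\<close>, so orthogonality applies.\<close>
  define b where "b j t = a j * exp (\<i> * of_real (of_int (j - m) * t))" for j t
  have b_sum: "((\<lambda>j. b j t) has_sum f t * exp (- \<i> * of_real (alpha \<alpha> m * t))) UNIV" for t
  proof -
    have "b j t = a j * exp (\<i> * of_real (alpha \<alpha> j * t)) * exp (- \<i> * of_real (alpha \<alpha> m * t))" for j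
      unfolding b_def alpha_def mult.assoc exp_add[symmetric]
      by (simp add: algebra_simps)
    with has_sum_cmult_left[OF sum] show ?thesis
      by simp
  qed
  have norm_b: "cmod (b j t) = cmod (a j)" for j t
    unfolding b_def norm_mult norm_exp_i_times by simp
  have "a summable_on UNIV"
    using sum[of 0] by (auto simp: summable_on_def)
  \<comment> \<open>Termwise integration with \<open>sums_integral\<close> concerns series over the
    naturals, hence the enumeration of the integers by \<open>int_decode\<close>.\<close>
  then have "(\<lambda>i. cmod (a (int_decode i))) summable_on UNIV"
    by (simp add: summable_on_iff_abs_summable_on_complex
        summable_on_reindex_bij_betw[OF bij_int_decode, of "\<lambda>j. cmod (a j)"])
  then have summ: "summable (\<lambda>i. cmod (a (int_decode i)))"
    by (rule summable_on_imp_summable)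
  have int: "integrable ?M (b j)" for j
    unfolding b_def by (intro integrable_mult_right integrable_interval_exp)
  have b_sums: "(\<lambda>i. b (int_decode i) t) sums (f t * exp (- \<i> * of_real (alpha \<alpha> m * t)))" for t
    using b_sum by (intro has_sum_imp_sums)
      (simp add: has_sum_reindex_bij_betw[OF bij_int_decode, of "\<lambda>j. b j t"])
  have "(\<lambda>i. integral\<^sup>L ?M (b (int_decode i))) sums (LINT t|?M. (\<Sum>i. b (int_decode i) t))"
  proof (rule sums_integral)
    show "summable (\<lambda>i. LINT t|?M. cmod (b (int_decode i) t))"
      by (simp add: norm_b summable_mult summ)
  qed (auto simp: int norm_b summ)
  moreover have "(\<Sum>i. b (int_decode i) t) = f t * exp (- \<i> * of_real (alpha \<alpha> m * t))" for t
    using b_sums by (rule sums_unique[symmetric])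
  moreover have "integral\<^sup>L ?M (b (int_decode i)) =
      (if i = int_encode m then of_real (2 * pi) * a m else 0)" for i
  proof -
    have "integral\<^sup>L ?M (b (int_decode i)) =
        a (int_decode i) * (if int_decode i - m = 0 then of_real (2 * pi) else 0)"
      unfolding b_def integral_mult_right_zero integral_interval_exp ..
    also have "\<dots> = (if i = int_encode m then of_real (2 * pi) * a m else 0)"
      by (auto simp del: of_real_mult)
    finally show ?thesis .
  qed
  ultimately have "(\<lambda>i. if i = int_encode m then of_real (2 * pi) * a m else 0) sums
      (LINT t|?M. f t * exp (- \<i> * of_real (alpha \<alpha> m * t)))"
    by simp
  then show ?thesis
    using sums_single[of "int_encode m" "\<lambda>_. of_real (2 * pi) * a m"] by (rule sums_unique2)
qed

text \<open>On the lines at height \<open>r\<close> and \<open>-r\<close>, mode \<open>j\<close>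
  carries the extra factor \<open>?e j\<close> gained between \<open>h\<close> and \<open>r\<close>.
  The exponential prefactor of the coefficient formula is its inverse, whether the mode propagates
  or not.\<close>

lemma coeff_eq_rayleigh:
  assumes exp: "rayleigh_expansion k \<alpha> h v up um" and r: "h \<le> r"
  shows "coeff_plus k \<alpha> h r v j = up j" and "coeff_minus k \<alpha> h r v j = um j"
proof -
  let ?e = "\<lambda>j. exp (\<i> * beta k \<alpha> j * of_real (r - h))"
  have e: "exp (- \<i> * beta k \<alpha> j * of_real (r - h)) * ?e j = 1"
    by (simp flip: exp_add)
  have "((\<lambda>j. (up j * ?e j) * exp (\<i> * of_real (alpha \<alpha> j * t))) has_sum v (t, r)) UNIV" for t
    using exp r unfolding rayleigh_expansion_def exp_add
    by (simp add: mult_ac)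
  from quasiperiodic_fourier_coefficient[OF this, of j] e
  show "coeff_plus k \<alpha> h r v j = up j"
    by (simp add: coeff_plus_def mult_ac)
  have "((\<lambda>j. (um j * ?e j) * exp (\<i> * of_real (alpha \<alpha> j * t))) has_sum v (t, -r)) UNIV" for t
  proof -
    \<comment> \<open>Downward propagation to \<open>-r\<close> gives the same factor
      \<open>?e j\<close> as upward propagation to \<open>r\<close>.\<close>
    have "\<i> * of_real (alpha \<alpha> j * t) - \<i> * beta k \<alpha> j * of_real (- r + h) =
        \<i> * of_real (alpha \<alpha> j * t) + \<i> * beta k \<alpha> j * of_real (r - h)" for j
      by (simp add: algebra_simps)
    moreover have "((\<lambda>j. um j * exp (\<i> * of_real (alpha \<alpha> j * t) - \<i> * beta k \<alpha> j * of_real (- r + h)))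
        has_sum v (t, -r)) UNIV"
      using exp neg_le_iff_le[THEN iffD2, OF r] unfolding rayleigh_expansion_def by blast
    ultimately show ?thesis
      by (simp only: exp_add mult_ac)
  qed
  from quasiperiodic_fourier_coefficient[OF this, of j] e
  show "coeff_minus k \<alpha> h r v j = um j"
    by (simp add: coeff_minus_def mult_ac)
qed

section \<open>Stability of the coefficients under noise\<close>

text \<open>The exponential has modulus one, so it disappears from the square integral; the factor
  \<open>2 * pi\<close> is the length of the interval in Cauchy-Schwarz.\<close>

lemma norm_fourier_coefficient_diff:
  fixes f g :: "real \<Rightarrow> complex"
  defines "M \<equiv> lebesgue_on {-pi<..<pi}"
  assumes f: "f \<in> borel_measurable M" "integrable M (\<lambda>t. (cmod (f t))\<^sup>2)"
    and g: "g \<in> borel_measurable M" "integrable M (\<lambda>t. (cmod (g t))\<^sup>2)"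
  shows "cmod ((LINT t|M. f t * exp (- \<i> * of_real (c * t))) -
      (LINT t|M. g t * exp (- \<i> * of_real (c * t))))
    \<le> sqrt (2 * pi * (LINT t|M. (cmod (f t - g t))\<^sup>2))"
proof -
  interpret finite_measure M
    unfolding M_def by (rule finite_measure_interval)
  define e where "e t = exp (- \<i> * of_real (c * t))" for t :: real
  have norm_e: "cmod (e t) = 1" for t
    using norm_exp_i_times[of "- (c * t)"] by (simp add: e_def)
  have e: "e \<in> borel_measurable M"
    using borel_measurable_integrable[OF integrable_interval_exp[of "-c"]]
    by (simp add: e_def[abs_def] M_def)
  have meas: "(\<lambda>t. u t * e t) \<in> borel_measurable M" if "u \<in> borel_measurable M" for u
    using that e by simp
  have sq: "(\<lambda>t. (cmod (u t * e t))\<^sup>2) = (\<lambda>t. (cmod (u t))\<^sup>2)" for u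
    by (simp add: norm_mult norm_e)
  have int: "integrable M (\<lambda>t. u t * e t)"
    if "u \<in> borel_measurable M" "integrable M (\<lambda>t. (cmod (u t))\<^sup>2)" for u
    using that by (intro norm_integral_le_sqrt(1)[OF meas]) (simp_all only: sq)
  have diff2: "integrable M (\<lambda>t. (cmod (f t - g t))\<^sup>2)"
  proof (rule Bochner_Integration.integrable_bound)
    show "integrable M (\<lambda>t. 2 * (cmod (f t))\<^sup>2 + 2 * (cmod (g t))\<^sup>2)"
      using f g by simp
    show "(\<lambda>t. (cmod (f t - g t))\<^sup>2) \<in> borel_measurable M"
      using f g by simp
    have "(cmod (x - y))\<^sup>2 \<le> 2 * (cmod x)\<^sup>2 + 2 * (cmod y)\<^sup>2" for x y
    proof -
      have "(cmod (x - y))\<^sup>2 \<le> (cmod x + cmod y)\<^sup>2"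
        by (simp add: norm_triangle_ineq4)
      also have "\<dots> \<le> 2 * (cmod x)\<^sup>2 + 2 * (cmod y)\<^sup>2"
        using zero_le_power2[of "cmod x - cmod y"]
        unfolding power2_diff power2_sum by linarith
      finally show ?thesis .
    qed
    then show "AE t in M. norm ((cmod (f t - g t))\<^sup>2) \<le> norm (2 * (cmod (f t))\<^sup>2 + 2 * (cmod (g t))\<^sup>2)"
      by simp
  qed
  \<comment> \<open>Merging the integrals rests on integrability of each product, since a Bochner
    integral of a non-integrable function defaults to 0.\<close>
  have "(LINT t|M. f t * e t) - (LINT t|M. g t * e t) = (LINT t|M. (f t - g t) * e t)"
    unfolding left_diff_distrib
    by (intro Bochner_Integration.integral_diff[symmetric] int f g)
  also have "cmod \<dots> \<le> sqrt (measure M (space M) * (LINT t|M. (cmod ((f t - g t) * e t))\<^sup>2))"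
    using f g by (intro norm_integral_le_sqrt(2)[OF meas]) (simp_all only: sq diff2 borel_measurable_diff)
  also have "\<dots> = sqrt (2 * pi * (LINT t|M. (cmod (f t - g t))\<^sup>2))"
    unfolding sq by (simp add: M_def measure_restrict_space)
  finally show ?thesis
    by (simp only: e_def)
qed

text \<open>A propagating mode has real \<open>beta\<close>, so its prefactor has modulus
  \<open>1 / (2 * pi)\<close>. Against the \<open>sqrt (2 * pi)\<close> from Cauchy-Schwarz this
  leaves a constant below 1.\<close>

lemma coeff_diff_le:
  assumes f: "L2_lines r f" and g: "L2_lines r g" and j: "j \<in> propagating k \<alpha>"
  shows "cmod (coeff_plus k \<alpha> h r f j - coeff_plus k \<alpha> h r g j) \<le> L2_lines_norm r (\<lambda>x. f x - g x)"
    and "cmod (coeff_minus k \<alpha> h r f j - coeff_minus k \<alpha> h r g j) \<le> L2_lines_norm r (\<lambda>x. f x - g x)"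
proof -
  let ?M = "lebesgue_on {-pi<..<pi}"
  let ?c = "\<lambda>u s. LINT t|?M. u (t, s) * exp (- \<i> * of_real (alpha \<alpha> j * t))"
  let ?S = "\<lambda>s. LINT t|?M. (cmod (f (t, s) - g (t, s)))\<^sup>2"
  have "Im (beta k \<alpha> j) = 0"
    using j by (simp add: propagating_def complex_is_Real_iff)
  then have phase: "cmod (exp (- \<i> * beta k \<alpha> j * of_real (r - h))) = 1"
    by simp
  have scaled: "cmod (exp (- \<i> * beta k \<alpha> j * of_real (r - h)) / of_real (2 * pi) * ?c f s
      - exp (- \<i> * beta k \<alpha> j * of_real (r - h)) / of_real (2 * pi) * ?c g s)
    \<le> L2_lines_norm r (\<lambda>x. f x - g x)" if s: "s \<in> {r, -r}" for s
  proof -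
    have "cmod (exp (- \<i> * beta k \<alpha> j * of_real (r - h)) / of_real (2 * pi) * ?c f s
        - exp (- \<i> * beta k \<alpha> j * of_real (r - h)) / of_real (2 * pi) * ?c g s)
        = cmod (?c f s - ?c g s) / (2 * pi)"
      unfolding right_diff_distrib[symmetric] norm_mult norm_divide phase by simp
    also have "\<dots> \<le> sqrt (2 * pi * ?S s) / (2 * pi)"
      using f g s unfolding L2_lines_def
      by (intro divide_right_mono norm_fourier_coefficient_diff) auto
    also have "\<dots> = sqrt (?S s) / sqrt (2 * pi)"
      by (simp add: real_sqrt_mult field_simps flip: power2_eq_square)
    also have "\<dots> \<le> sqrt (?S s) / 1"
      using pi_gt3 by (intro divide_left_mono) auto
    \<comment> \<open>The square integral over one line is at most the sum over both lines.\<close>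
    also have "\<dots> \<le> L2_lines_norm r (\<lambda>x. f x - g x)"
      using s unfolding L2_lines_norm_def by (auto intro!: real_sqrt_le_mono)
    finally show ?thesis .
  qed
  show "cmod (coeff_plus k \<alpha> h r f j - coeff_plus k \<alpha> h r g j) \<le> L2_lines_norm r (\<lambda>x. f x - g x)"
    unfolding coeff_plus_def by (rule scaled) simp
  show "cmod (coeff_minus k \<alpha> h r f j - coeff_minus k \<alpha> h r g j) \<le> L2_lines_norm r (\<lambda>x. f x - g x)"
    unfolding coeff_minus_def by (rule scaled) simp
qed

section \<open>From coefficient errors to the imaging functional\<close>

lemma bigo_cmult:
  fixes f :: "'a \<Rightarrow> 'b::real_normed_field"
  shows "f \<in> O[F](g) \<Longrightarrow> (\<lambda>x. c * f x) \<in> O[F](g)"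
  by (cases "c = 0") simp_all

text \<open>Induction on \<open>p\<close>, splitting the next difference as
  \<open>f x * (f x ^ p - c ^ p) + c ^ p * (f x - c)\<close>. The first factor stays bounded because
  \<open>f\<close> differs from \<open>c\<close> by a multiple of the bounded
  \<open>g\<close>.\<close>

lemma power_diff_bigo:
  fixes f :: "'a \<Rightarrow> 'b::real_normed_field"
  assumes diff: "(\<lambda>x. f x - c) \<in> O[F](g)" and g: "g \<in> O[F](\<lambda>_. 1)"
  shows "(\<lambda>x. f x ^ p - c ^ p) \<in> O[F](g)"
proof (induction p)
  case (Suc p)
  have "(\<lambda>x. (f x - c) + c) \<in> O[F](\<lambda>_. 1)"
    by (intro sum_in_bigo landau_o.big_trans[OF diff g]) simp
  then have f: "f \<in> O[F](\<lambda>_. 1)"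
    by simp
  have "(\<lambda>x. f x * (f x ^ p - c ^ p)) \<in> O[F](\<lambda>x. 1 * g x)"
    by (rule landau_o.big.mult[OF f Suc])
  moreover have "(\<lambda>x. c ^ p * (f x - c)) \<in> O[F](g)"
    using diff by (rule bigo_cmult)
  ultimately have "(\<lambda>x. f x * (f x ^ p - c ^ p) + c ^ p * (f x - c)) \<in> O[F](g)"
    by (intro sum_in_bigo) simp_all
  then show ?case
    by (simp add: algebra_simps)
qed simp

text \<open>With \<open>z\<close> fixed, \<open>beta\<close> and the conjugated
  \<open>g_plus\<close> and \<open>g_minus\<close> are constants as \<delta> varies. The comparison
  function is \<open>of_real\<close> in the hypotheses because the coefficient errors are
  complex.\<close>

lemma imaging_functional_bigo:
  fixes vp vm :: "real \<Rightarrow> nat \<Rightarrow> int \<Rightarrow> complex"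
  assumes "\<And>l j. l \<in> {1..N} \<Longrightarrow> j \<in> propagating k \<alpha> \<Longrightarrow>
      (\<lambda>\<delta>. vp \<delta> l j - up l j) \<in> O[at_right 0](of_real)"
    and "\<And>l j. l \<in> {1..N} \<Longrightarrow> j \<in> propagating k \<alpha> \<Longrightarrow>
      (\<lambda>\<delta>. vm \<delta> l j - um l j) \<in> O[at_right 0](of_real)"
  shows "(\<lambda>\<delta>. imaging_functional k \<alpha> h p N (vp \<delta>) (vm \<delta>) z
      - imaging_functional k \<alpha> h p N up um z) \<in> O[at_right 0](\<lambda>\<delta>. \<delta>)"
proof -
  define W where "W vp vm = (\<Sum>j\<in>propagating k \<alpha>. beta k \<alpha> j *
      (vp j * cnj (g_plus k \<alpha> h j z) + vm j * cnj (g_minus k \<alpha> h j z)))"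
    for vp vm :: "int \<Rightarrow> complex"
  have "(\<lambda>\<delta>. cmod (W (vp \<delta> l) (vm \<delta> l)) ^ p - cmod (W (up l) (um l)) ^ p)
      \<in> O[at_right 0](\<lambda>\<delta>. \<delta>)" if l: "l \<in> {1..N}" for l
  proof (rule power_diff_bigo)
    let ?w = "\<lambda>\<delta>. W (vp \<delta> l) (vm \<delta> l) - W (up l) (um l)"
    have "(\<lambda>\<delta>. \<Sum>j\<in>propagating k \<alpha>.
        (beta k \<alpha> j * cnj (g_plus k \<alpha> h j z)) * (vp \<delta> l j - up l j)
        + (beta k \<alpha> j * cnj (g_minus k \<alpha> h j z)) * (vm \<delta> l j - um l j)) \<in> O[at_right 0](of_real)"
      using assms l by (intro big_sum_in_bigo sum_in_bigo(1) bigo_cmult) auto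
    also have "(\<lambda>\<delta>. \<Sum>j\<in>propagating k \<alpha>.
        (beta k \<alpha> j * cnj (g_plus k \<alpha> h j z)) * (vp \<delta> l j - up l j)
        + (beta k \<alpha> j * cnj (g_minus k \<alpha> h j z)) * (vm \<delta> l j - um l j)) = ?w"
      unfolding W_def by (simp add: algebra_simps flip: sum_subtractf)
    finally have "?w \<in> O[at_right 0](of_real)" .
    \<comment> \<open>The explicit constant carries the complex estimate over to the real moduli, by
      the reverse triangle inequality.\<close>
    then obtain c where c: "\<forall>\<^sub>F \<delta> in at_right 0. cmod (?w \<delta>) \<le> c * norm (complex_of_real \<delta>)"
      by (elim landau_o.bigE)
    show "(\<lambda>\<delta>. cmod (W (vp \<delta> l) (vm \<delta> l)) - cmod (W (up l) (um l))) \<in> O[at_right 0](\<lambda>\<delta>. \<delta>)"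
      using c by (intro bigoI[of _ c], elim eventually_mono)
        (simp add: order_trans[OF norm_triangle_ineq3])
    show "(\<lambda>\<delta>. \<delta>) \<in> O[at_right 0](\<lambda>_. 1 :: real)"
      using eventually_at_right_real[of 0 1] by (intro bigoI[of _ 1]) (auto elim: eventually_mono)
  qed
  then have "(\<lambda>\<delta>. \<Sum>l=1..N. cmod (W (vp \<delta> l) (vm \<delta> l)) ^ p - cmod (W (up l) (um l)) ^ p)
      \<in> O[at_right 0](\<lambda>\<delta>. \<delta>)"
    by (rule big_sum_in_bigo)
  then show ?thesis
    unfolding imaging_functional_def W_def by (simp add: sum_subtractf)
qed

theorem theorem3:
  fixes k \<alpha> h r :: real
    and p N :: nat
    and n :: "real \<times> real \<Rightarrow> complex"
    and uin usc :: "nat \<Rightarrow> real \<times> real \<Rightarrow> complex"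
    and up um :: "nat \<Rightarrow> int \<Rightarrow> complex"
    and usc\<delta> :: "real \<Rightarrow> nat \<Rightarrow> real \<times> real \<Rightarrow> complex"
    and z :: "real \<times> real"
  assumes "k > 0" and "p \<ge> 1" and "N \<ge> 1"
    and "periodic_medium n"
    and "h > 0" and "(SUP x\<in>scatterer (contrast n). ereal \<bar>snd x\<bar>) < ereal h" and "r \<ge> h"
    and "\<And>j. beta k \<alpha> j \<noteq> 0"
    and "\<And>l. l \<in> {1..N} \<Longrightarrow> quasiperiodic \<alpha> (uin l) \<and> L2_loc (uin l)"
    and "\<And>l. l \<in> {1..N} \<Longrightarrow> scattered_field k \<alpha> h n (uin l) (usc l) (up l) (um l)"
    and "\<And>l. l \<in> {1..N} \<Longrightarrow> L2_lines r (usc l)"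
    and "\<And>\<delta> l. \<delta> > 0 \<Longrightarrow> l \<in> {1..N} \<Longrightarrow> L2_lines r (usc\<delta> \<delta> l)"
    and "\<And>\<delta>. \<delta> > 0 \<Longrightarrow> (\<Sum>l=1..N. L2_lines_norm r (\<lambda>x. usc\<delta> \<delta> l x - usc l x)) \<le> \<delta>"
    and "z \<in> \<Omega>"
  shows "(\<lambda>\<delta>. \<bar>imaging_functional k \<alpha> h p N
                  (\<lambda>l. coeff_plus k \<alpha> h r (usc\<delta> \<delta> l)) (\<lambda>l. coeff_minus k \<alpha> h r (usc\<delta> \<delta> l)) z
              - imaging_functional k \<alpha> h p N up um z\<bar>) \<in> O[at_right 0](\<lambda>\<delta>. \<delta>)"
proof -
  have noise: "L2_lines_norm r (\<lambda>x. usc\<delta> \<delta> l x - usc l x) \<le> \<delta>" if "\<delta> > 0" "l \<in> {1..N}" for \<delta> l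
  proof -
    have "L2_lines_norm r (\<lambda>x. usc\<delta> \<delta> l x - usc l x) \<le>
        (\<Sum>l=1..N. L2_lines_norm r (\<lambda>x. usc\<delta> \<delta> l x - usc l x))"
      using that by (intro member_le_sum) (auto simp: L2_lines_norm_def)
    with assms(13)[OF \<open>\<delta> > 0\<close>] show ?thesis
      by linarith
  qed
  \<comment> \<open>The filter \<open>at_right 0\<close> sees only positive \<delta>, where the
    noise bound gives the constant 1.\<close>
  have bigo: "f \<in> O[at_right 0](of_real)" if "\<And>\<delta>. \<delta> > 0 \<Longrightarrow> cmod (f \<delta>) \<le> \<delta>" for f :: "real \<Rightarrow> complex"
    using that by (intro bigoI[of _ 1] eventually_mono[OF eventually_at_right_less]) auto
  have exact: "coeff_plus k \<alpha> h r (usc l) j = up l j" "coeff_minus k \<alpha> h r (usc l) j = um l j"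
    if "l \<in> {1..N}" for l j
    using assms(10)[OF that] \<open>r \<ge> h\<close> coeff_eq_rayleigh
    unfolding scattered_field_def by blast+
  have "(\<lambda>\<delta>. imaging_functional k \<alpha> h p N
        (\<lambda>l. coeff_plus k \<alpha> h r (usc\<delta> \<delta> l)) (\<lambda>l. coeff_minus k \<alpha> h r (usc\<delta> \<delta> l)) z
      - imaging_functional k \<alpha> h p N up um z) \<in> O[at_right 0](\<lambda>\<delta>. \<delta>)"
  proof (rule imaging_functional_bigo; rule bigo)
    fix l j and \<delta> :: real
    assume l: "l \<in> {1..N}" and j: "j \<in> propagating k \<alpha>" and \<delta>: "\<delta> > 0"
    \<comment> \<open>Unfolding \<open>exact\<close> replaces the line integrals of the exact field
      by the coefficients \<open>up\<close> and \<open>um\<close> of its expansion.\<close>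
    note diff = coeff_diff_le[OF assms(12)[OF \<delta> l] assms(11)[OF l] j, of h, unfolded exact[OF l]]
    show "cmod (coeff_plus k \<alpha> h r (usc\<delta> \<delta> l) j - up l j) \<le> \<delta>"
      using diff(1) noise[OF \<delta> l] by (rule order_trans)
    show "cmod (coeff_minus k \<alpha> h r (usc\<delta> \<delta> l) j - um l j) \<le> \<delta>"
      using diff(2) noise[OF \<delta> l] by (rule order_trans)
  qed
  then show ?thesis
    by (rule landau_o.big.abs_in_iff[THEN iffD2])
qed

end
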